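(* Let $\delta\in[0,1)$ and $\psi_\delta(z)=(1-\delta)\frac{1+z}{1-z}+\delta$. Let $\varphi(z)=z+\sum_{k=2}^\infty\alpha_kz^k$ be a univalent starlike function (with respect to the origin) in the open unit disk $\mathbb{D}$, and let $F\in\mathcal{A}_{\varphi,\psi_\delta}$. Let $\lambda\in\mathbb{C}$ and denote $\Delta_\delta:=\{\lambda\in\mathbb{C}: |1-2\lambda(1-\delta)|+|1-2\lambda|<1\}$. Then $$\left|\Phi_1(F,\lambda)\right|\le \max(1,|4\lambda-3|)+2(1-\delta)\kappa(\lambda),$$ where $$\kappa(\lambda)=\left\{\begin{array}{lcl} |1-2\lambda(1-\delta)|+2|1-2\lambda|, & \quad & \mbox{if } \lambda\notin\Delta_\delta,\\[2mm] 1+\frac{|1-2\lambda|^2}{1-|1-2\lambda(1-\delta)|}, & \quad & \mbox{if } \lambda\in\Delta_\delta. \end{array}\right.$$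
   Context: $\mathcal{A}_{\varphi,\psi}$ is the class of functions $F$ holomorphic in $\mathbb{D}$ of the form $F(z)=\varphi(z)\psi(\omega(z))$, $z\in\mathbb{D}$, for some holomorphic self-mapping $\omega$ of $\mathbb{D}$ with $\omega(0)=0$. For $f(z)=\sum_{k=0}^\infty f_kz^k$ and $\lambda\in\mathbb{C}$, $\Phi_1(f,\lambda):=f_1f_3-\lambda f_2^2$. *)

theory Defs
  imports "HOL-Complex_Analysis.Complex_Analysis"
begin

abbreviation unit_disk :: "complex set" (\<open>\<D>\<close>)
  where "\<D> \<equiv> ball 0 1"

(* The image is starlike in the library's sense with the centre fixed to be the origin. *)
definition univalent_starlike :: "(complex \<Rightarrow> complex) \<Rightarrow> bool"
  where "univalent_starlike \<phi> \<longleftrightarrow>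
    \<phi> holomorphic_on \<D> \<and> inj_on \<phi> \<D> \<and>
    0 \<in> \<phi> ` \<D> \<and> (\<forall>w\<in>\<phi> ` \<D>. closed_segment 0 w \<subseteq> \<phi> ` \<D>)"

(* Functions are total in HOL, so the values of a member outside the disk are unconstrained. *)
definition class_A :: "(complex \<Rightarrow> complex) \<Rightarrow> (complex \<Rightarrow> complex) \<Rightarrow> (complex \<Rightarrow> complex) set"
  where "class_A \<phi> \<psi> = {F. F holomorphic_on \<D> \<and>
    (\<exists>\<omega>. \<omega> holomorphic_on \<D> \<and> \<omega> ` \<D> \<subseteq> \<D> \<and> \<omega> 0 = 0 \<and> (\<forall>z\<in>\<D>. F z = \<phi> z * \<psi> (\<omega> z)))}"

definition psi :: "real \<Rightarrow> complex \<Rightarrow> complex"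
  where "psi \<delta> z = (1 - of_real \<delta>) * ((1 + z) / (1 - z)) + of_real \<delta>"

definition taylor_coeff :: "(complex \<Rightarrow> complex) \<Rightarrow> nat \<Rightarrow> complex"
  where "taylor_coeff f k = fps_nth (fps_expansion f 0) k"

definition Phi1 :: "(complex \<Rightarrow> complex) \<Rightarrow> complex \<Rightarrow> complex"
  where "Phi1 f lam = taylor_coeff f 1 * taylor_coeff f 3 - lam * (taylor_coeff f 2)\<^sup>2"

definition Delta :: "real \<Rightarrow> complex set"
  where "Delta \<delta> = {lam. cmod (1 - 2 * lam * (1 - of_real \<delta>)) + cmod (1 - 2 * lam) < 1}"

definition kappa :: "real \<Rightarrow> complex \<Rightarrow> real"
  where "kappa \<delta> lam =
    (if lam \<notin> Delta \<delta>
     then cmod (1 - 2 * lam * (1 - of_real \<delta>)) + 2 * cmod (1 - 2 * lam)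
     else 1 + (cmod (1 - 2 * lam))\<^sup>2 / (1 - cmod (1 - 2 * lam * (1 - of_real \<delta>))))"

end

theory Submission
  imports Defs
begin

text \<open>
  Write \<open>b = 2 (1 - \<delta>)\<close>, \<open>\<phi> z = z + a\<^sub>2 z\<^sup>2 + a\<^sub>3 z\<^sup>3 + \<dots>\<close> and \<open>\<omega> z = c\<^sub>1 z + c\<^sub>2 z\<^sup>2 + \<dots>\<close>. Expanding
  \<open>F = \<phi> \<cdot> (\<psi>\<^sub>\<delta> \<circ> \<omega>)\<close> up to the third order splits the functional into a part that sees only
  \<open>\<phi>\<close> and a part that is controlled by \<open>\<omega>\<close> and \<open>\<bar>a\<^sub>2\<bar>\<close>:
  \<open>\<Phi>\<^sub>1(F, \<lambda>) = (a\<^sub>3 - \<lambda> a\<^sub>2\<^sup>2) + b (a\<^sub>2 c\<^sub>1 (1 - 2\<lambda>) + c\<^sub>2 + c\<^sub>1\<^sup>2 (1 - b\<lambda>))\<close>.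
  The first summand is the Fekete-Szego functional of a starlike function, bounded by
  \<open>max 1 \<bar>4\<lambda> - 3\<bar>\<close>. In the second one \<open>\<bar>a\<^sub>2\<bar> \<le> 2\<close> and \<open>\<bar>c\<^sub>2\<bar> \<le> 1 - \<bar>c\<^sub>1\<bar>\<^sup>2\<close> leave a real quadratic in
  \<open>t = \<bar>c\<^sub>1\<bar> \<in> [0,1]\<close>, whose maximum is \<open>\<kappa>(\<lambda>)\<close>; the set \<open>\<Delta>\<^sub>\<delta>\<close> consists of those \<open>\<lambda>\<close> for which
  the parabola opens downwards and has its vertex to the left of \<open>1\<close>.

  All facts about starlike functions come from one source. If the image of \<open>\<phi>\<close> is starlike,
  then \<open>z \<mapsto> \<phi>\<^sup>-\<^sup>1 (t \<phi> z)\<close> is, for \<open>0 \<le> t < 1\<close>, a self-map of the disk fixing \<open>0\<close>, so the Schwarz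
  lemma says that \<open>t \<mapsto> \<bar>\<phi>\<^sup>-\<^sup>1 (t \<phi> z)\<bar>\<close> is largest at \<open>t = 1\<close>. The sign of its derivative there is
  that of \<open>Re (\<phi> z / (z \<phi>' z))\<close> (lemma \<open>starlike_Re_nonneg\<close>). The Cayley transform turns this into a
  function \<open>v\<close> to which the Schwarz lemma applies again, with \<open>z \<phi>' / \<phi> = (1 + v) / (1 - v)\<close>
  (lemma \<open>starlike_Schwarz_function\<close>), and \<open>a\<^sub>2, a\<^sub>3\<close> are polynomials in the first two coefficients of \<open>v\<close>.
\<close>

section \<open>Coefficients of holomorphic functions on the disk\<close>

lemma holomorphic_on_disk_has_fps_expansion:
  assumes "f holomorphic_on \<D>"
  shows "f has_fps_expansion fps_expansion f 0"
  by (rule has_fps_expansion_fps_expansion[OF _ _ assms]) auto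

lemma fps_eq_if_eq_on_disk:
  fixes f g :: "complex \<Rightarrow> complex"
  assumes "f has_fps_expansion A" "g has_fps_expansion B" "\<And>z. z \<in> \<D> \<Longrightarrow> f z = g z"
  shows "A = B"
proof -
  have "eventually (\<lambda>z::complex. z \<in> \<D>) (nhds 0)"
    by (rule eventually_nhds_in_open) auto
  then have "eventually (\<lambda>z. f z = g z) (nhds 0)"
    by eventually_elim (use assms(3) in auto)
  then have "g has_fps_expansion A"
    using has_fps_expansion_cong[of f g A A] assms(1) by simp
  then show ?thesis
    using assms(2) fps_expansion_unique_complex by blast
qed

lemma taylor_coeff_0: "taylor_coeff f 0 = f 0"
  and taylor_coeff_1: "taylor_coeff f 1 = deriv f 0"
  by (simp_all add: taylor_coeff_def fps_expansion_def)

section \<open>Functions satisfying the hypotheses of the Schwarz lemma\<close>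

definition Schwarz_function :: "(complex \<Rightarrow> complex) \<Rightarrow> bool"
  where "Schwarz_function \<omega> \<longleftrightarrow> \<omega> holomorphic_on \<D> \<and> \<omega> ` \<D> \<subseteq> \<D> \<and> \<omega> 0 = 0"

lemma Schwarz_function_coeff_1:
  assumes "Schwarz_function \<omega>"
  shows "cmod (taylor_coeff \<omega> 1) \<le> 1"
  using assms Schwarz_Lemma(2)[of \<omega> 0]
  by (auto simp del: One_nat_def simp: Schwarz_function_def taylor_coeff_1 image_subset_iff)

text \<open>
  Divide by \<open>z\<close>: the coefficients in question are the first two of \<open>h = \<omega>(z)/z\<close>, which is bounded by
  \<open>1\<close>. Unless \<open>\<omega>\<close> is a rotation, \<open>\<bar>h\<bar> < 1\<close>, and the Moebius transformation that moves \<open>h 0\<close> to \<open>0\<close>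
  reduces the estimate to the bound on the derivative in the Schwarz lemma.
\<close>
lemma Schwarz_function_coeff_2:
  assumes "Schwarz_function \<omega>"
  shows "cmod (taylor_coeff \<omega> 2) \<le> 1 - (cmod (taylor_coeff \<omega> 1))\<^sup>2"
proof -
  have hol: "\<omega> holomorphic_on \<D>" and \<omega>0: "\<omega> 0 = 0"
    and bd: "\<And>z. cmod z < 1 \<Longrightarrow> cmod (\<omega> z) < 1"
    using assms by (auto simp: Schwarz_function_def image_subset_iff)
  obtain h where h: "h holomorphic_on \<D>" "\<And>z. cmod z < 1 \<Longrightarrow> \<omega> z = z * h z" "deriv \<omega> 0 = h 0"
    using Schwarz3[OF hol \<omega>0] by metis
  define H where "H = fps_expansion h 0"
  have hH: "h has_fps_expansion H"
    unfolding H_def by (rule holomorphic_on_disk_has_fps_expansion[OF h(1)])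
  have "fps_expansion \<omega> 0 = fps_X * H"
    by (rule fps_eq_if_eq_on_disk[OF holomorphic_on_disk_has_fps_expansion[OF hol]])
       (auto intro!: fps_expansion_intros hH simp: h(2))
  then have c2: "taylor_coeff \<omega> 2 = H $ 1"
    by (simp add: taylor_coeff_def)
  have c1: "taylor_coeff \<omega> 1 = h 0"
    by (simp only: taylor_coeff_1 h(3))
  have H0: "H $ 0 = h 0"
    by (simp add: H_def fps_expansion_def)
  note rot = Schwarz_Lemma(3)[OF hol \<omega>0 bd, of 0, simplified]
  show ?thesis
  proof (cases "cmod (h 0) = 1")
    case True
    then obtain a where a: "\<And>z. cmod z < 1 \<Longrightarrow> \<omega> z = a * z"
      using rot h(3) by auto
    have "fps_expansion \<omega> 0 = fps_const a * fps_X"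
      by (rule fps_eq_if_eq_on_disk[OF holomorphic_on_disk_has_fps_expansion[OF hol]])
         (auto intro!: fps_expansion_intros simp: a)
    then have "taylor_coeff \<omega> 2 = 0"
      by (simp add: taylor_coeff_def)
    with True c1 show ?thesis by simp
  next
    case False
    have hlt: "cmod (h z) < 1" if z: "cmod z < 1" for z
    proof (cases "z = 0")
      case True
      then show ?thesis
        using Schwarz_Lemma(2)[OF hol \<omega>0 bd, of 0] h(3) False by simp
    next
      case nz: False
      have "cmod (\<omega> z) \<le> cmod z"
        using Schwarz_Lemma(1)[OF hol \<omega>0 bd z] .
      moreover have "cmod (\<omega> z) \<noteq> cmod z"
      proof
        assume eq: "cmod (\<omega> z) = cmod z"
        obtain a where a: "\<And>z. cmod z < 1 \<Longrightarrow> \<omega> z = a * z" and "cmod a = 1"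
          using Schwarz_Lemma(3)[OF hol \<omega>0 bd z] z nz eq by blast
        have "fps_expansion \<omega> 0 = fps_const a * fps_X"
          by (rule fps_eq_if_eq_on_disk[OF holomorphic_on_disk_has_fps_expansion[OF hol]])
             (auto intro!: fps_expansion_intros simp: a)
        then have "taylor_coeff \<omega> 1 = a"
          by (simp add: taylor_coeff_def)
        with \<open>cmod a = 1\<close> c1 False show False by simp
      qed
      ultimately show ?thesis
        using h(2)[OF z] nz by (auto simp: norm_mult)
    qed
    define k :: "complex \<Rightarrow> complex" where "k = Moebius_function 0 (h 0) \<circ> h"
    have h0: "cmod (h 0) < 1" by (rule hlt) simp
    have kbd: "cmod (k z) < 1" if "cmod z < 1" for z
      unfolding k_def o_def by (rule Moebius_function_norm_lt_1[OF h0 hlt[OF that]])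
    have holk: "k holomorphic_on \<D>"
      unfolding k_def
      by (rule holomorphic_on_compose_gen[OF h(1) Moebius_function_holomorphic[OF h0]])
         (use hlt in auto)
    have k0: "k 0 = 0"
      by (simp add: k_def Moebius_function_def)
    define K where "K = fps_expansion k 0"
    have kK: "k has_fps_expansion K"
      unfolding K_def by (rule holomorphic_on_disk_has_fps_expansion[OF holk])
    have keq: "k z * (1 - cnj (h 0) * h z) = h z - h 0" if "z \<in> \<D>" for z
    proof -
      have "cmod (cnj (h 0) * h z) < 1"
        using mult_strict_mono'[of "cmod (h 0)" 1 "cmod (h z)" 1] h0 hlt[of z] that
        by (simp add: norm_mult)
      then have "cnj (h 0) * h z \<noteq> 1" by auto
      then show ?thesis by (simp add: k_def Moebius_function_def)
    qed
    have "K * (1 - fps_const (cnj (h 0)) * H) = H - fps_const (h 0)"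
      by (rule fps_eq_if_eq_on_disk[OF _ _ keq]) (auto intro!: fps_expansion_intros kK hH)
    then have "(K * (1 - fps_const (cnj (h 0)) * H)) $ 1 = (H - fps_const (h 0)) $ 1"
      by simp
    moreover have "K $ 0 = 0" and K1: "K $ 1 = deriv k 0"
      by (simp_all add: K_def fps_expansion_def k0)
    ultimately have "deriv k 0 * (1 - cnj (h 0) * h 0) = H $ 1"
      by (simp add: fps_mult_nth_1 H0)
    moreover have "1 - cnj (h 0) * h 0 = of_real (1 - (cmod (h 0))\<^sup>2)"
      by (simp add: complex_norm_square mult.commute del: of_real_power)
    ultimately have "cmod (H $ 1) = cmod (deriv k 0) * \<bar>1 - (cmod (h 0))\<^sup>2\<bar>"
      by (metis norm_mult norm_of_real)
    moreover have "(cmod (h 0))\<^sup>2 \<le> 1"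
      using h0 by (simp add: power_le_one)
    moreover have "cmod (deriv k 0) \<le> 1"
      using Schwarz_Lemma(2)[OF holk k0 kbd, of 0] by simp
    ultimately have "cmod (H $ 1) \<le> 1 - (cmod (h 0))\<^sup>2"
      using mult_right_mono[of "cmod (deriv k 0)" 1 "1 - (cmod (h 0))\<^sup>2"] by simp
    then show ?thesis by (simp only: c1 c2)
  qed
qed

text \<open>
  By the maximum modulus principle a value of modulus \<open>1\<close> inside the disk would make \<open>v\<close> constant,
  against \<open>v 0 = 0\<close>; so a non-strict bound suffices.
\<close>
lemma Schwarz_functionI:
  assumes hol: "v holomorphic_on \<D>" and v0: "v 0 = 0" and le: "\<And>z. z \<in> \<D> \<Longrightarrow> cmod (v z) \<le> 1"
  shows "Schwarz_function v"
proof -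
  have "cmod (v z) < 1" if z: "z \<in> \<D>" for z
  proof (rule ccontr)
    assume "\<not> cmod (v z) < 1"
    then have "v constant_on \<D>"
      using le z by (intro maximum_modulus_principle[OF hol _ _ _ _ z]) force+
    then have "v z = v 0"
      using z unfolding constant_on_def by (metis centre_in_ball zero_less_one)
    with \<open>\<not> cmod (v z) < 1\<close> v0 show False by simp
  qed
  with hol v0 show ?thesis by (auto simp: Schwarz_function_def)
qed

section \<open>Starlike functions\<close>

text \<open>
  Geometrically: moving the image point \<open>\<phi> z\<close> radially towards the origin must not increase the
  modulus of its preimage.
\<close>
lemma starlike_Re_nonneg:
  assumes star: "univalent_starlike \<phi>" and \<phi>0: "\<phi> 0 = 0" and z: "z \<in> \<D>"
  shows "Re (cnj z * (\<phi> z / deriv \<phi> z)) \<ge> 0"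
proof -
  have hol: "\<phi> holomorphic_on \<D>" and inj: "inj_on \<phi> \<D>"
    and seg: "\<And>w. w \<in> \<phi> ` \<D> \<Longrightarrow> closed_segment 0 w \<subseteq> \<phi> ` \<D>"
    using star by (auto simp: univalent_starlike_def)
  obtain g where g: "g holomorphic_on (\<phi> ` \<D>)"
      "\<And>z. z \<in> \<D> \<Longrightarrow> deriv \<phi> z * deriv g (\<phi> z) = 1" "\<And>z. z \<in> \<D> \<Longrightarrow> g (\<phi> z) = z"
    using holomorphic_has_inverse[OF hol open_ball inj] by metis
  have opn: "open (\<phi> ` \<D>)"
    by (rule open_mapping_thm3[OF hol open_ball inj])
  have in_image: "of_real t * \<phi> x \<in> \<phi> ` \<D>" if "x \<in> \<D>" "0 \<le> t" "t \<le> 1" for x and t :: real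
    using seg[of "\<phi> x"] that by (force simp: in_segment scaleR_conv_of_real)
  have shrink: "cmod (g (of_real t * \<phi> z)) \<le> cmod z" if t: "0 \<le> t" "t \<le> 1" for t :: real
  proof -
    \<comment> \<open>the self-map of the disk obtained by shrinking the image by the factor \<open>t\<close>\<close>
    define G where "G x = g (of_real t * \<phi> x)" for x
    have "(g \<circ> (\<lambda>x. of_real t * \<phi> x)) holomorphic_on \<D>"
      by (rule holomorphic_on_compose_gen[OF _ g(1)])
         (use in_image t in \<open>auto intro!: holomorphic_intros hol\<close>)
    then have "G holomorphic_on \<D>"
      by (simp add: G_def[abs_def] o_def)
    moreover have "G 0 = 0"
      using g(3)[of 0] by (simp add: G_def \<phi>0)
    moreover have "cmod (G x) < 1" if "cmod x < 1" for x
    proof -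
      obtain y where "y \<in> \<D>" "of_real t * \<phi> x = \<phi> y"
        using in_image[of x t] t \<open>cmod x < 1\<close> by auto
      then show ?thesis using g(3)[of y] by (simp add: G_def)
    qed
    ultimately show ?thesis
      using Schwarz_Lemma(1)[of G z] z by (simp add: G_def)
  qed
  define u where "u t = g (of_real t * \<phi> z)" for t :: real
  have u1: "u 1 = z" by (simp add: u_def g(3)[OF z])
  have "(g has_field_derivative deriv g (\<phi> z)) (at (\<phi> z))"
    using holomorphic_derivI[OF g(1) opn] z by blast
  moreover have "((\<lambda>t. of_real t * \<phi> z) has_vector_derivative \<phi> z) (at 1)"
    by (auto intro!: derivative_eq_intros simp: has_vector_derivative_def scaleR_conv_of_real)
  ultimately have "((g \<circ> (\<lambda>t. of_real t * \<phi> z)) has_vector_derivative \<phi> z * deriv g (\<phi> z)) (at 1)"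
    by (intro field_vector_diff_chain_at) auto
  moreover have "deriv g (\<phi> z) = 1 / deriv \<phi> z"
    using inverse_unique[OF g(2)[OF z]] by (simp add: inverse_eq_divide)
  ultimately have "(u has_vector_derivative \<phi> z / deriv \<phi> z) (at 1)"
    by (simp add: u_def[abs_def] o_def)
  then have du: "(u has_derivative (\<lambda>h. h *\<^sub>R (\<phi> z / deriv \<phi> z))) (at 1)"
    by (simp add: has_vector_derivative_def)
  have "((\<lambda>t. u t \<bullet> u t) has_derivative
         (\<lambda>h. u 1 \<bullet> (h *\<^sub>R (\<phi> z / deriv \<phi> z)) + (h *\<^sub>R (\<phi> z / deriv \<phi> z)) \<bullet> u 1)) (at 1)"
    by (rule has_derivative_inner[OF du du])
  then have D: "((\<lambda>t. u t \<bullet> u t) has_real_derivative 2 * (z \<bullet> (\<phi> z / deriv \<phi> z))) (at 1)"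
    unfolding has_field_derivative_def
    by (rule has_derivative_eq_rhs) (auto simp: u1 inner_commute)
  have "\<not> z \<bullet> (\<phi> z / deriv \<phi> z) < 0"
  proof
    assume "z \<bullet> (\<phi> z / deriv \<phi> z) < 0"
    then obtain d where d: "d > 0" "\<And>h. 0 < h \<Longrightarrow> h < d \<Longrightarrow> u 1 \<bullet> u 1 < u (1 - h) \<bullet> u (1 - h)"
      using DERIV_neg_dec_left[OF D] by auto
    define h where "h = min (d / 2) 1"
    have h: "0 < h" "h < d" "h \<le> 1" using d(1) by (auto simp: h_def)
    have "cmod (u (1 - h)) \<le> cmod (u 1)"
      using shrink[of "1 - h"] h by (simp add: u1) (simp add: u_def)
    then have "u (1 - h) \<bullet> u (1 - h) \<le> u 1 \<bullet> u 1"
      by (simp add: dot_square_norm power_mono)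
    with d(2)[OF h(1,2)] show False by simp
  qed
  then show ?thesis
    by (simp only: inner_complex_def times_complex.sel cnj.sel)
qed

text \<open>
  The Cayley transform of \<open>z \<phi>' / \<phi>\<close>, which has non-negative real part. Factoring out the zero of
  \<open>\<phi>\<close> at the origin removes the singularity, and the product form of the conclusion is the one that
  can be read off coefficient by coefficient.
\<close>
lemma starlike_Schwarz_function:
  assumes star: "univalent_starlike \<phi>" and \<phi>0: "\<phi> 0 = 0"
  obtains v where "Schwarz_function v"
    and "\<And>z. z \<in> \<D> \<Longrightarrow> z * deriv \<phi> z * (1 - v z) = \<phi> z * (1 + v z)"
proof -
  have hol: "\<phi> holomorphic_on \<D>" and inj: "inj_on \<phi> \<D>"
    using star by (auto simp: univalent_starlike_def)
  have hold: "deriv \<phi> holomorphic_on \<D>"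
    by (intro holomorphic_deriv hol) auto
  have dnz: "deriv \<phi> z \<noteq> 0" if "z \<in> \<D>" for z
    using holomorphic_injective_imp_regular[OF hol _ inj that] by simp
  obtain h where h: "h holomorphic_on \<D>" "\<And>z. cmod z < 1 \<Longrightarrow> \<phi> z = z * h z" "deriv \<phi> 0 = h 0"
    using Schwarz3[OF hol \<phi>0] by metis
  have Re: "Re (h z / deriv \<phi> z) \<ge> 0" if z: "z \<in> \<D>" for z
  proof (cases "z = 0")
    case True
    then show ?thesis using dnz[of 0] h(3) by simp
  next
    case False
    have "cnj z * (\<phi> z / deriv \<phi> z) = of_real ((cmod z)\<^sup>2) * (h z / deriv \<phi> z)"
      unfolding h(2)[of z, OF z[unfolded mem_ball_0]] complex_norm_square by simp
    then have "Re (cnj z * (\<phi> z / deriv \<phi> z)) = (cmod z)\<^sup>2 * Re (h z / deriv \<phi> z)"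
      by (simp only: times_complex.sel Re_complex_of_real Im_complex_of_real)
    then show ?thesis
      using starlike_Re_nonneg[OF star \<phi>0 z] False by (simp add: zero_le_mult_iff)
  qed
  have nz: "deriv \<phi> z + h z \<noteq> 0" if "z \<in> \<D>" for z
  proof
    assume "deriv \<phi> z + h z = 0"
    then have "h z = - deriv \<phi> z" by (simp add: add_eq_0_iff)
    then have "h z / deriv \<phi> z = -1" using dnz[OF that] by simp
    with Re[OF that] show False by simp
  qed
  define v where "v z = (deriv \<phi> z - h z) / (deriv \<phi> z + h z)" for z
  have "cmod (v z) \<le> 1" if z: "z \<in> \<D>" for z
  proof -
    define q where "q = h z / deriv \<phi> z"
    have hq: "h z = q * deriv \<phi> z" using dnz[OF z] by (simp add: q_def)
    have "(cmod (1 - q))\<^sup>2 \<le> (cmod (1 + q))\<^sup>2"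
      using Re[OF z] unfolding q_def[symmetric] cmod_power2
      by (simp add: power2_eq_square algebra_simps)
    then have "cmod (1 - q) \<le> cmod (1 + q)"
      by (rule power2_le_imp_le) simp
    then have "cmod (deriv \<phi> z) * cmod (1 - q) \<le> cmod (deriv \<phi> z) * cmod (1 + q)"
      by (rule mult_left_mono) simp
    then have "cmod (deriv \<phi> z - h z) \<le> cmod (deriv \<phi> z + h z)"
      unfolding hq norm_mult[symmetric] by (simp add: algebra_simps)
    then show ?thesis
      using nz[OF z] by (simp add: v_def norm_divide)
  qed
  moreover have "v holomorphic_on \<D>"
    unfolding v_def by (intro holomorphic_intros hold h(1) nz)
  moreover have "v 0 = 0" by (simp add: v_def h(3))
  ultimately have "Schwarz_function v"
    by (intro Schwarz_functionI)
  moreover have "z * deriv \<phi> z * (1 - v z) = \<phi> z * (1 + v z)" if z: "z \<in> \<D>" for z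
  proof -
    have "1 - v z = 2 * h z / (deriv \<phi> z + h z)" "1 + v z = 2 * deriv \<phi> z / (deriv \<phi> z + h z)"
      using nz[OF z] by (auto simp: v_def field_simps)
    then show ?thesis using h(2)[of z] z by simp
  qed
  ultimately show ?thesis using that by blast
qed

lemma starlike_coeffs:
  assumes star: "univalent_starlike \<phi>" and \<phi>0: "\<phi> 0 = 0" and \<phi>1: "taylor_coeff \<phi> 1 = 1"
  obtains v where "Schwarz_function v" "taylor_coeff \<phi> 2 = 2 * taylor_coeff v 1"
    "taylor_coeff \<phi> 3 = taylor_coeff v 2 + 3 * (taylor_coeff v 1)\<^sup>2"
proof -
  obtain v where v: "Schwarz_function v"
    and eq: "\<And>z. z \<in> \<D> \<Longrightarrow> z * deriv \<phi> z * (1 - v z) = \<phi> z * (1 + v z)"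
    using starlike_Schwarz_function[OF star \<phi>0] by blast
  define P V where "P = fps_expansion \<phi> 0" and "V = fps_expansion v 0"
  have P: "\<phi> has_fps_expansion P"
    unfolding P_def using star
    by (intro holomorphic_on_disk_has_fps_expansion) (simp add: univalent_starlike_def)
  have V: "v has_fps_expansion V"
    unfolding V_def using v
    by (intro holomorphic_on_disk_has_fps_expansion) (simp add: Schwarz_function_def)
  have "fps_X * fps_deriv P * (1 - V) = P * (1 + V)"
    by (rule fps_eq_if_eq_on_disk[OF _ _ eq]) (auto intro!: fps_expansion_intros P V)
  then have e: "(fps_X * (fps_deriv P * (1 - V))) $ n = (P * (1 + V)) $ n" for n
    by (simp add: mult.assoc)
  have P0: "P $ 0 = 0" and V0: "V $ 0 = 0" and P1: "P $ Suc 0 = 1"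
    using \<phi>0 v \<phi>1 by (simp_all add: P_def V_def fps_expansion_def Schwarz_function_def taylor_coeff_def)
  have a2: "P $ 2 = 2 * V $ 1"
    using e[of 2] by (simp add: fps_mult_nth eval_nat_numeral P0 V0 P1)
  have "2 * P $ 3 = 2 * (V $ 2 + 3 * (V $ 1)\<^sup>2)"
    using e[of 3] a2
    by (simp add: fps_mult_nth eval_nat_numeral P0 V0 P1)
  then have a3: "P $ 3 = V $ 2 + 3 * (V $ 1)\<^sup>2"
    by (subst (asm) mult_cancel_left) simp
  show ?thesis
    using that[OF v] a2 a3 by (simp add: taylor_coeff_def P_def V_def)
qed

lemma starlike_coeff_2_bound:
  assumes "univalent_starlike \<phi>" "\<phi> 0 = 0" "taylor_coeff \<phi> 1 = 1"
  shows "cmod (taylor_coeff \<phi> 2) \<le> 2"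
proof -
  obtain v where "Schwarz_function v" "taylor_coeff \<phi> 2 = 2 * taylor_coeff v 1"
    using starlike_coeffs[OF assms] by metis
  then show ?thesis
    using Schwarz_function_coeff_1[of v] by (simp add: norm_mult)
qed

text \<open>
  In terms of \<open>v\<close> the functional is \<open>v\<^sub>2 + (3 - 4\<lambda>) v\<^sub>1\<^sup>2\<close>, and \<open>\<bar>v\<^sub>2\<bar> \<le> 1 - \<bar>v\<^sub>1\<bar>\<^sup>2\<close> bounds it by a convex
  combination of \<open>1\<close> and \<open>\<bar>4\<lambda> - 3\<bar>\<close>.
\<close>
lemma starlike_Fekete_Szego:
  assumes "univalent_starlike \<phi>" "\<phi> 0 = 0" "taylor_coeff \<phi> 1 = 1"
  shows "cmod (taylor_coeff \<phi> 3 - lam * (taylor_coeff \<phi> 2)\<^sup>2) \<le> max 1 (cmod (4 * lam - 3))"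
proof -
  obtain v where v: "Schwarz_function v" and a: "taylor_coeff \<phi> 2 = 2 * taylor_coeff v 1"
    "taylor_coeff \<phi> 3 = taylor_coeff v 2 + 3 * (taylor_coeff v 1)\<^sup>2"
    using starlike_coeffs[OF assms] by metis
  define s M where "s = (cmod (taylor_coeff v 1))\<^sup>2" and "M = max 1 (cmod (4 * lam - 3))"
  have s: "0 \<le> s" "s \<le> 1"
    using Schwarz_function_coeff_1[OF v] by (auto simp: s_def power_le_one)
  have "taylor_coeff \<phi> 3 - lam * (taylor_coeff \<phi> 2)\<^sup>2
      = taylor_coeff v 2 - (4 * lam - 3) * (taylor_coeff v 1)\<^sup>2"
    unfolding a by (simp add: algebra_simps power2_eq_square)
  then have "cmod (taylor_coeff \<phi> 3 - lam * (taylor_coeff \<phi> 2)\<^sup>2)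
      \<le> cmod (taylor_coeff v 2) + cmod (4 * lam - 3) * s"
    by (simp add: s_def norm_triangle_le_diff norm_mult norm_power)
  also have "\<dots> \<le> (1 - s) * M + M * s"
  proof (rule add_mono)
    have "(1 - s) * 1 \<le> (1 - s) * M"
      using s by (intro mult_left_mono) (auto simp: M_def)
    then show "cmod (taylor_coeff v 2) \<le> (1 - s) * M"
      using Schwarz_function_coeff_2[OF v] by (simp add: s_def)
    show "cmod (4 * lam - 3) * s \<le> M * s"
      using s by (intro mult_right_mono) (auto simp: M_def)
  qed
  also have "\<dots> = M" by (simp add: algebra_simps)
  finally show ?thesis by (simp add: M_def)
qed

section \<open>The functional on the class\<close>

text \<open>
  Clearing the denominator of \<open>\<psi>\<^sub>\<delta>\<close>, whose numerator is \<open>1 + (1 - 2\<delta>) z\<close>, avoids composing power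
  series: the coefficients of \<open>F\<close> follow from \<open>F (1 - \<omega>) = \<phi> (1 + (1 - 2\<delta>) \<omega>)\<close>.
\<close>
lemma class_A_coeffs:
  assumes hol: "\<phi> holomorphic_on \<D>" and \<phi>0: "\<phi> 0 = 0" and \<phi>1: "taylor_coeff \<phi> 1 = 1"
    and F: "F \<in> class_A \<phi> (psi \<delta>)"
  obtains \<omega> where "Schwarz_function \<omega>" "taylor_coeff F 1 = 1"
    "taylor_coeff F 2 = taylor_coeff \<phi> 2 + 2 * (1 - of_real \<delta>) * taylor_coeff \<omega> 1"
    "taylor_coeff F 3 = taylor_coeff \<phi> 3 + 2 * (1 - of_real \<delta>) *
      (taylor_coeff \<phi> 2 * taylor_coeff \<omega> 1 + taylor_coeff \<omega> 2 + (taylor_coeff \<omega> 1)\<^sup>2)"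
proof -
  obtain \<omega> where holF: "F holomorphic_on \<D>" and w: "Schwarz_function \<omega>"
    and Feq: "\<And>z. z \<in> \<D> \<Longrightarrow> F z = \<phi> z * psi \<delta> (\<omega> z)"
    using F by (auto simp: class_A_def Schwarz_function_def)
  define d where "d = complex_of_real \<delta>"
  define P W G where "P = fps_expansion \<phi> 0" and "W = fps_expansion \<omega> 0" and "G = fps_expansion F 0"
  have P: "\<phi> has_fps_expansion P" and G: "F has_fps_expansion G"
    unfolding P_def G_def by (intro holomorphic_on_disk_has_fps_expansion hol holF)+
  have W: "\<omega> has_fps_expansion W"
    unfolding W_def using w
    by (intro holomorphic_on_disk_has_fps_expansion) (simp add: Schwarz_function_def)
  have eq: "F z * (1 - \<omega> z) = \<phi> z * (1 + (1 - 2 * d) * \<omega> z)" if z: "z \<in> \<D>" for z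
  proof -
    have "cmod (\<omega> z) < 1"
      using w z by (auto simp: Schwarz_function_def image_subset_iff)
    then have "\<omega> z \<noteq> 1" by auto
    then have "psi \<delta> (\<omega> z) * (1 - \<omega> z) = 1 + (1 - 2 * d) * \<omega> z"
      by (simp add: psi_def d_def field_simps)
    then show ?thesis by (simp add: Feq[OF z] mult.assoc)
  qed
  have "G * (1 - W) = P * (1 + fps_const (1 - 2 * d) * W)"
    by (rule fps_eq_if_eq_on_disk[OF _ _ eq]) (auto intro!: fps_expansion_intros P W G)
  then have e: "(G * (1 - W)) $ n = (P * (1 + fps_const (1 - 2 * d) * W)) $ n" for n
    by simp
  have P0: "P $ 0 = 0" and W0: "W $ 0 = 0" and P1: "P $ Suc 0 = 1"
    using \<phi>0 w \<phi>1 by (simp_all add: P_def W_def fps_expansion_def Schwarz_function_def taylor_coeff_def)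
  have G0: "G $ 0 = 0"
    using e[of 0] by (simp add: P0 W0)
  have G1: "G $ Suc 0 = 1"
    using e[of 1] by (simp add: fps_mult_nth P0 W0 P1 G0)
  have G2: "G $ 2 = P $ 2 + 2 * (1 - d) * W $ 1"
    using e[of 2] by (simp add: fps_mult_nth eval_nat_numeral P0 W0 P1 G0 G1) (simp add: algebra_simps)
  have G3: "G $ 3 = P $ 3 + 2 * (1 - d) * (P $ 2 * W $ 1 + W $ 2 + (W $ 1)\<^sup>2)"
    using e[of 3] G2
    by (simp add: fps_mult_nth eval_nat_numeral P0 W0 P1 G0 G1) (simp add: algebra_simps)
  show ?thesis
    using that[OF w] G1 G2 G3 by (simp add: taylor_coeff_def P_def W_def G_def d_def)
qed

text \<open>
  The left-hand side is \<open>1 - (1 - A) t\<^sup>2 + 2 B t\<close> with \<open>A = \<bar>1 - 2\<lambda>(1-\<delta>)\<bar>\<close> and \<open>B = \<bar>1 - 2\<lambda>\<bar>\<close>. On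
  \<open>\<Delta>\<^sub>\<delta>\<close>, that is for \<open>A + B < 1\<close>, its vertex \<open>B / (1 - A)\<close> lies in \<open>[0,1)\<close>; otherwise it is
  non-decreasing on \<open>[0,1]\<close> and the value at \<open>t = 1\<close> is the maximum.
\<close>
lemma quadratic_le_kappa:
  assumes t: "0 \<le> t" "t \<le> 1"
  shows "1 - t\<^sup>2 + cmod (1 - 2 * lam * (1 - of_real \<delta>)) * t\<^sup>2 + 2 * cmod (1 - 2 * lam) * t
    \<le> kappa \<delta> lam"
proof -
  define A B where "A = cmod (1 - 2 * lam * (1 - of_real \<delta>))" and "B = cmod (1 - 2 * lam)"
  have AB: "0 \<le> A" "0 \<le> B" by (simp_all add: A_def B_def)
  have "1 - t\<^sup>2 + A * t\<^sup>2 + 2 * B * t \<le> kappa \<delta> lam"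
  proof (cases "lam \<in> Delta \<delta>")
    case True
    then have lt: "A + B < 1" by (simp add: Delta_def A_def B_def)
    have "1 + B\<^sup>2 / (1 - A) - (1 - t\<^sup>2 + A * t\<^sup>2 + 2 * B * t) = ((1 - A) * t - B)\<^sup>2 / (1 - A)"
      using lt AB by (simp add: field_simps power2_eq_square)
    moreover have "((1 - A) * t - B)\<^sup>2 / (1 - A) \<ge> 0"
      using lt AB by simp
    moreover have "kappa \<delta> lam = 1 + B\<^sup>2 / (1 - A)"
      using True by (simp add: kappa_def A_def B_def)
    ultimately show ?thesis by linarith
  next
    case False
    then have ge: "1 - A \<le> B" by (simp add: Delta_def A_def B_def)
    have "(1 - A) * (1 + t) \<le> B * (1 + t)"
      using ge t by (intro mult_right_mono) auto
    also have "\<dots> \<le> B * 2"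
      using AB t by (intro mult_left_mono) auto
    finally have "(1 - t) * (2 * B - (1 - A) * (1 + t)) \<ge> 0"
      using t by (intro mult_nonneg_nonneg) auto
    moreover have "A + 2 * B - (1 - t\<^sup>2 + A * t\<^sup>2 + 2 * B * t)
        = (1 - t) * (2 * B - (1 - A) * (1 + t))"
      by (simp add: algebra_simps power2_eq_square)
    moreover have "kappa \<delta> lam = A + 2 * B"
      using False by (simp add: kappa_def A_def B_def)
    ultimately show ?thesis by linarith
  qed
  then show ?thesis by (simp add: A_def B_def)
qed

lemma Schwarz_function_kappa_bound:
  assumes w: "Schwarz_function \<omega>" and a: "cmod a \<le> 2"
  shows "cmod (a * taylor_coeff \<omega> 1 * (1 - 2 * lam) + taylor_coeff \<omega> 2
      + (taylor_coeff \<omega> 1)\<^sup>2 * (1 - 2 * lam * (1 - of_real \<delta>))) \<le> kappa \<delta> lam"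
proof -
  define t where "t = cmod (taylor_coeff \<omega> 1)"
  have t: "0 \<le> t" "t \<le> 1"
    using Schwarz_function_coeff_1[OF w] by (auto simp: t_def)
  have 1: "cmod (a * taylor_coeff \<omega> 1 * (1 - 2 * lam)) \<le> 2 * cmod (1 - 2 * lam) * t"
    using mult_right_mono[OF a, of "t * cmod (1 - 2 * lam)"]
    by (simp add: norm_mult t_def mult_ac)
  have 2: "cmod (taylor_coeff \<omega> 2) \<le> 1 - t\<^sup>2"
    using Schwarz_function_coeff_2[OF w] by (simp add: t_def)
  have 3: "cmod ((taylor_coeff \<omega> 1)\<^sup>2 * (1 - 2 * lam * (1 - of_real \<delta>)))
      = cmod (1 - 2 * lam * (1 - of_real \<delta>)) * t\<^sup>2"
    by (simp add: norm_mult norm_power t_def)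
  show ?thesis
    by (rule order_trans[OF order_trans[OF norm_triangle_ineq
          add_right_mono[OF norm_triangle_ineq]] ])
       (use 1 2 3 quadratic_le_kappa[OF t, of lam \<delta>] in linarith)
qed

lemma normalized_power_series_coeff_1:
  assumes "\<And>z. z \<in> \<D> \<Longrightarrow> (\<lambda>k. \<alpha> (k + 2) * z ^ (k + 2)) sums (\<phi> z - z)"
  shows "\<phi> 0 = 0" "taylor_coeff \<phi> 1 = 1"
proof -
  define C where "C = Abs_fps (\<lambda>n. if n = 0 then 0 else if n = 1 then 1 else \<alpha> n)"
  have sums: "(\<lambda>n. C $ n * z ^ n) sums \<phi> z" if "z \<in> \<D>" for z
  proof -
    have "(\<lambda>k. C $ (k + 2) * z ^ (k + 2)) sums (\<phi> z - z)"
      using assms[OF that] by (simp add: C_def)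
    then have "(\<lambda>n. C $ n * z ^ n) sums (\<phi> z - z + (\<Sum>n<2. C $ n * z ^ n))"
      using sums_iff_shift[of "\<lambda>n. C $ n * z ^ n" 2] by blast
    moreover have "(\<Sum>n<2. C $ n * z ^ n) = z"
      by (simp add: C_def eval_nat_numeral)
    ultimately show ?thesis by simp
  qed
  have "eventually (\<lambda>z::complex. z \<in> \<D>) (nhds 0)"
    by (rule eventually_nhds_in_open) auto
  then have "\<phi> has_fps_expansion C"
    by (intro has_fps_expansionI) (auto elim!: eventually_mono simp: sums)
  then have eq: "fps_expansion \<phi> 0 = C"
    by (rule fps_expansion_eqI)
  show "taylor_coeff \<phi> 1 = 1"
    by (simp add: taylor_coeff_def eq C_def)
  show "\<phi> 0 = 0"
    by (simp add: taylor_coeff_0[symmetric] taylor_coeff_def eq C_def)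
qed

theorem theorem5p1:
  fixes \<delta> :: real and \<phi> F :: "complex \<Rightarrow> complex" and \<alpha> :: "nat \<Rightarrow> complex" and lam :: complex
  assumes "0 \<le> \<delta>" and "\<delta> < 1"
    and "\<And>z. z \<in> \<D> \<Longrightarrow> (\<lambda>k. \<alpha> (k + 2) * z ^ (k + 2)) sums (\<phi> z - z)"
    and "univalent_starlike \<phi>"
    and "F \<in> class_A \<phi> (psi \<delta>)"
  shows "cmod (Phi1 F lam) \<le> max 1 (cmod (4 * lam - 3)) + 2 * (1 - \<delta>) * kappa \<delta> lam"
proof -
  note norm = normalized_power_series_coeff_1[OF assms(3)]
  have hol: "\<phi> holomorphic_on \<D>"
    using assms(4) by (simp add: univalent_starlike_def)
  define a2 a3 where "a2 = taylor_coeff \<phi> 2" and "a3 = taylor_coeff \<phi> 3"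
  obtain \<omega> where w: "Schwarz_function \<omega>" and F1: "taylor_coeff F 1 = 1"
    and F2: "taylor_coeff F 2 = a2 + 2 * (1 - of_real \<delta>) * taylor_coeff \<omega> 1"
    and F3: "taylor_coeff F 3 = a3 + 2 * (1 - of_real \<delta>) *
      (a2 * taylor_coeff \<omega> 1 + taylor_coeff \<omega> 2 + (taylor_coeff \<omega> 1)\<^sup>2)"
    using class_A_coeffs[OF hol norm assms(5)] unfolding a2_def a3_def by metis
  define R where "R = a2 * taylor_coeff \<omega> 1 * (1 - 2 * lam) + taylor_coeff \<omega> 2
      + (taylor_coeff \<omega> 1)\<^sup>2 * (1 - 2 * lam * (1 - of_real \<delta>))"
  have "Phi1 F lam = (a3 - lam * a2\<^sup>2) + of_real (2 * (1 - \<delta>)) * R"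
    unfolding Phi1_def F1 F2 F3 R_def by (simp add: algebra_simps power2_eq_square)
  then have "cmod (Phi1 F lam) \<le> cmod (a3 - lam * a2\<^sup>2) + cmod (of_real (2 * (1 - \<delta>)) * R)"
    by (simp only: norm_triangle_ineq)
  also have "cmod (of_real (2 * (1 - \<delta>)) * R) = 2 * (1 - \<delta>) * cmod R"
    using assms(2) by (simp only: norm_mult norm_of_real) simp
  also have "cmod (a3 - lam * a2\<^sup>2) \<le> max 1 (cmod (4 * lam - 3))"
    unfolding a2_def a3_def by (rule starlike_Fekete_Szego[OF assms(4) norm])
  also have "2 * (1 - \<delta>) * cmod R \<le> 2 * (1 - \<delta>) * kappa \<delta> lam"
    using assms(2) Schwarz_function_kappa_bound[OF w starlike_coeff_2_bound[OF assms(4) norm]]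
    unfolding R_def a2_def by (intro mult_left_mono) auto
  finally show ?thesis by simp
qed

end
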